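(* Let $1\le k\le n-1$ and let $W_\sigma$ be a stratum in $G_{n,k}$. Then all points of $W_\sigma$ have the same stabilizer $\mathbb{C}^*_\sigma\subset(\mathbb{C}^* )^n$ for the canonical action of $(\mathbb{C}^* )^n$ on $G_{n,k}$.
   Context: $G_{n,k}$ is the Grassmann manifold of $k$-dimensional complex subspaces of $\mathbb{C}^n$ with the action of the algebraic torus $(\mathbb{C}^* )^n$ induced by the coordinatewise action on $\mathbb{C}^n$. For $I\subset\{1,\dots,n\}$, $|I|=k$, $P^I(L)$ denotes the Pl\"ucker coordinate of $L$ (the $k\times k$ minor on the rows $I$ of an $n\times k$ matrix whose columns form a basis of $L$). For a set $\sigma$ of $k$-element subsets of $\{1,\dots,n\}$ let $W_\sigma=\{L\in G_{n,k}: P^I(L)\ne0 \text{ for } I\in\sigma,\ P^I(L)=0\text{ for }I\notin\sigma\}$; if nonempty, $W_\sigma$ is called a stratum. *)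

theory Defs
  imports
    "Jordan_Normal_Form.DL_Rank"
    "Jordan_Normal_Form.DL_Submatrix"
    "HOL-Algebra.Group_Action"
    "HOL-Algebra.Product_Groups"
begin

text \<open>Coordinates of \<open>\<complex>\<^sup>n\<close> are numbered \<open>0, \<dots>, n - 1\<close>, as always for \<^typ>\<open>complex vec\<close>, so
  index sets are subsets of \<open>{..<n}\<close>. Only the underlying set of the Grassmann manifold is used.\<close>

abbreviation cspace :: "nat \<Rightarrow> (complex, complex vec) module" where
  "cspace n \<equiv> module_vec TYPE(complex) n"

definition grassmannian :: "nat \<Rightarrow> nat \<Rightarrow> complex vec set set" where
  "grassmannian n k =
    {L. VectorSpace.subspace class_ring L (cspace n) \<and>
        vectorspace.dim class_ring ((cspace n)\<lparr>carrier := L\<rparr>) = k}"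

definition basis_matrix :: "nat \<Rightarrow> nat \<Rightarrow> complex vec set \<Rightarrow> complex mat \<Rightarrow> bool" where
  "basis_matrix n k L A \<longleftrightarrow> A \<in> carrier_mat n k \<and> distinct (cols A) \<and>
     vectorspace.basis class_ring ((cspace n)\<lparr>carrier := L\<rparr>) (set (cols A))"

definition row_minor :: "complex mat \<Rightarrow> nat set \<Rightarrow> complex" where
  "row_minor A I = det (submatrix A I UNIV)"

text \<open>Pluecker coordinates are homogeneous: they depend on the basis matrix through a common
  nonzero factor. The definition fixes some basis matrix; see \<open>plucker_proportional\<close> below.\<close>

definition plucker :: "nat \<Rightarrow> nat \<Rightarrow> complex vec set \<Rightarrow> nat set \<Rightarrow> complex" where
  "plucker n k L I = row_minor (SOME A. basis_matrix n k L A) I"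

definition stratum :: "nat \<Rightarrow> nat \<Rightarrow> nat set set \<Rightarrow> complex vec set set" where
  "stratum n k \<sigma> =
    {L \<in> grassmannian n k.
       \<forall>I. I \<subseteq> {..<n} \<and> card I = k \<longrightarrow>
         (I \<in> \<sigma> \<longrightarrow> plucker n k L I \<noteq> 0) \<and> (I \<notin> \<sigma> \<longrightarrow> plucker n k L I = 0)}"

definition torus :: "nat \<Rightarrow> (nat \<Rightarrow> complex) monoid" where
  "torus n = product_group {..<n} (\<lambda>_. units_of (class_ring :: complex ring))"

definition coord_action :: "nat \<Rightarrow> (nat \<Rightarrow> complex) \<Rightarrow> complex vec \<Rightarrow> complex vec" where
  "coord_action n t v = vec n (\<lambda>i. t i * v $ i)"

definition torus_action ::
    "nat \<Rightarrow> nat \<Rightarrow> (nat \<Rightarrow> complex) \<Rightarrow> complex vec set \<Rightarrow> complex vec set" where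
  "torus_action n k t = (\<lambda>L \<in> grassmannian n k. coord_action n t ` L)"


text \<open>Well-definedness of the Pluecker coordinates up to a common nonzero factor.\<close>

lemma carrier_cspace [simp]: "carrier (cspace n) = carrier_vec n"
  by (simp add: module_vec_simps)

lemma grassmannianD:
  assumes "L \<in> grassmannian n k"
  shows "VectorSpace.subspace class_ring L (cspace n)"
    and "vectorspace class_ring ((cspace n)\<lparr>carrier := L\<rparr>)"
    and "vectorspace.dim class_ring ((cspace n)\<lparr>carrier := L\<rparr>) = k"
    and "L \<subseteq> carrier_vec n"
proof -
  interpret V: vec_space "TYPE(complex)" n .
  show s: "VectorSpace.subspace class_ring L (cspace n)"
    and "vectorspace.dim class_ring ((cspace n)\<lparr>carrier := L\<rparr>) = k"
    using assms by (auto simp: grassmannian_def)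
  then show "vectorspace class_ring ((cspace n)\<lparr>carrier := L\<rparr>)"
    by (intro V.subspace_is_vs)
  show "L \<subseteq> carrier_vec n"
    using s unfolding VectorSpace.subspace_def by (metis LinearCombinations.submodule.subset carrier_cspace)
qed

lemma subspace_fin_dim:
  assumes s: "VectorSpace.subspace class_ring L (cspace n)"
  shows "vectorspace.fin_dim class_ring ((cspace n)\<lparr>carrier := L\<rparr>)"
proof -
  interpret V: vec_space "TYPE(complex)" n .
  interpret W: vectorspace class_ring "(cspace n)\<lparr>carrier := L\<rparr>"
    using V.subspace_is_vs[OF s] .
  have sm: "submodule class_ring L (cspace n)" and Lc: "L \<subseteq> carrier_vec n"
    using s LinearCombinations.submodule.subset[of class_ring L "cspace n"]
    unfolding VectorSpace.subspace_def carrier_cspace by auto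
  let ?P = "\<lambda>S. S \<subseteq> L \<and> V.lin_indpt S"
  have bound: "finite S \<and> card S \<le> n" if "?P S" for S
    using V.li_le_dim[of S] that Lc V.fin_dim V.dim_is_n by auto
  have "\<exists>A. finite A \<and> maximal A ?P"
  proof (rule maximal_exists[of ?P n "{}"])
    show "\<And>A. ?P A \<Longrightarrow> finite A \<and> card A \<le> n" using bound by auto
    show "?P {}" by (auto simp: V.lin_dep_def)
  qed
  then obtain A where A: "finite A" "maximal A ?P" by blast
  have AL: "A \<subseteq> L" using A(2) by (auto simp: maximal_def)
  have "maximal A (\<lambda>S. S \<subseteq> carrier ((cspace n)\<lparr>carrier := L\<rparr>) \<and> W.lin_indpt S)"
    using A(2) V.span_li_not_depend(2)[OF _ sm] unfolding maximal_def by auto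
  then have "W.gen_set A" by (rule W.max_li_is_gen)
  then show ?thesis using A(1) AL unfolding W.fin_dim_def by auto
qed

lemma basis_matrix_exists:
  assumes L: "L \<in> grassmannian n k"
  shows "\<exists>A. basis_matrix n k L A"
proof -
  interpret W: vectorspace class_ring "(cspace n)\<lparr>carrier := L\<rparr>"
    using grassmannianD(2)[OF L] .
  obtain B where B: "finite B" "W.basis B"
    using W.finite_basis_exists subspace_fin_dim[OF grassmannianD(1)[OF L]] by blast
  have c: "card B = k" using W.dim_basis[OF B] grassmannianD(3)[OF L] by simp
  have BL: "B \<subseteq> carrier_vec n" using B(2) grassmannianD(4)[OF L] by (auto simp: W.basis_def)
  obtain bs where bs: "set bs = B" "distinct bs" using finite_distinct_list[OF B(1)] by blast
  have len: "length bs = k" using bs c distinct_card by fastforce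
  have "cols (mat_of_cols n bs) = bs" using BL bs by simp
  then have "basis_matrix n k L (mat_of_cols n bs)"
    using B(2) bs len mat_of_cols_carrier(1)[of n bs] by (simp add: basis_matrix_def)
  then show ?thesis ..
qed

lemma basis_matrix_span:
  assumes L: "L \<in> grassmannian n k" and A: "basis_matrix n k L A"
  shows "{A *\<^sub>v x | x. x \<in> carrier_vec k} = L"
    and "\<And>x. x \<in> carrier_vec k \<Longrightarrow> A *\<^sub>v x = 0\<^sub>v n \<Longrightarrow> x = 0\<^sub>v k"
proof -
  interpret V: vec_space "TYPE(complex)" n .
  interpret W: vectorspace class_ring "(cspace n)\<lparr>carrier := L\<rparr>"
    using grassmannianD(2)[OF L] .
  have sm: "submodule class_ring L (cspace n)"
    using grassmannianD(1)[OF L] unfolding VectorSpace.subspace_def by auto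
  have Ac: "A \<in> carrier_mat n k" and d: "distinct (cols A)" and b: "W.basis (set (cols A))"
    using A by (auto simp: basis_matrix_def)
  have sub: "set (cols A) \<subseteq> L" using b by (auto simp: W.basis_def)
  have span: "V.span (set (cols A)) = L" and li: "V.lin_indpt (set (cols A))"
    using b V.span_li_not_depend[OF sub sm] by (auto simp: W.basis_def)
  have cA: "set (cols A) \<subseteq> carrier_vec n" using sub grassmannianD(4)[OF L] by auto
  have "V.span (set (cols A)) = {A *\<^sub>v x | x. x \<in> carrier_vec k}"
  proof (intro equalityI subsetI)
    fix v assume "v \<in> V.span (set (cols A))"
    then obtain a where "v = V.lincomb a (set (cols A))"
      using V.finite_span[OF _ cA] by auto
    then have "v = A *\<^sub>v vec k (\<lambda>i. a (col A i))"
      using V.mat_mult_eq_lincomb[OF Ac d] by simp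
    then show "v \<in> {A *\<^sub>v x | x. x \<in> carrier_vec k}" by auto
  next
    fix v assume "v \<in> {A *\<^sub>v x | x. x \<in> carrier_vec k}"
    then obtain x where "x \<in> carrier_vec k" "v = A *\<^sub>v x" by auto
    then have "v = V.lincomb (\<lambda>a. x $ find_first a (cols A)) (set (cols A))"
      using V.lincomb_eq_mat_mult[OF Ac _ d] by simp
    then show "v \<in> V.span (set (cols A))"
      using V.finite_span[OF _ cA] by auto
  qed
  with span show "{A *\<^sub>v x | x. x \<in> carrier_vec k} = L" by simp
  show "x = 0\<^sub>v k" if "x \<in> carrier_vec k" "A *\<^sub>v x = 0\<^sub>v n" for x
    using V.lin_depI[OF Ac that(1) _ that(2) d] li by blast
qed

lemma basis_matrix_change:
  assumes L: "L \<in> grassmannian n k" and A: "basis_matrix n k L A" and B: "basis_matrix n k L B"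
  shows "\<exists>C \<in> carrier_mat k k. A = B * C"
proof -
  have Ac: "A \<in> carrier_mat n k" and Bc: "B \<in> carrier_mat n k"
    using A B by (auto simp: basis_matrix_def)
  have "\<exists>x \<in> carrier_vec k. col A j = B *\<^sub>v x" if "j < k" for j
  proof -
    have "col A j = A *\<^sub>v unit_vec k j"
      using Ac that by (intro eq_vecI) auto
    then have "col A j \<in> L" using basis_matrix_span(1)[OF L A] by auto
    then show ?thesis using basis_matrix_span(1)[OF L B] by auto
  qed
  then obtain x where x: "\<And>j. j < k \<Longrightarrow> x j \<in> carrier_vec k \<and> col A j = B *\<^sub>v x j" by metis
  let ?C = "mat_of_cols k (map x [0..<k])"
  have Cc: "?C \<in> carrier_mat k k" using mat_of_cols_carrier(1)[of k "map x [0..<k]"] by simp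
  have "A = B * ?C"
  proof (rule mat_col_eqI)
    fix j assume "j < dim_col (B * ?C)"
    then have j: "j < k" using Cc by simp
    have "col ?C j = x j" using x[OF j] j by (subst col_mat_of_cols) auto
    moreover have "col (B * ?C) j = B *\<^sub>v col ?C j" using col_mult2[OF Bc Cc j] .
    ultimately show "col A j = col (B * ?C) j" using x[OF j] by simp
  qed (use Ac Bc in auto)
  with Cc show ?thesis by blast
qed

lemma row_minor_mult:
  assumes B: "B \<in> carrier_mat n k" and C: "C \<in> carrier_mat k k"
    and I: "I \<subseteq> {..<n}" "card I = k"
  shows "row_minor (B * C) I = row_minor B I * det C"
proof -
  have cI: "card {i. i < n \<and> i \<in> I} = k"
    using I by (intro trans[OF arg_cong[of _ _ card] I(2)]) auto
  have pick: "pick I i < n" if "i < k" for i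
    using pick_le[of i n I] that cI by simp
  have sB: "submatrix B I UNIV \<in> carrier_mat k k"
    using B cI by (auto simp: submatrix_def)
  have "submatrix (B * C) I UNIV = submatrix B I UNIV * C"
    using B C cI pick
    by (intro eq_matI)
       (auto simp: submatrix_def pick_UNIV scalar_prod_def intro!: sum.cong)
  then show ?thesis using det_mult[OF sB C] by (simp add: row_minor_def)
qed

lemma plucker_proportional:
  assumes L: "L \<in> grassmannian n k" and A: "basis_matrix n k L A"
  shows "\<exists>c. c \<noteq> 0 \<and> (\<forall>I. I \<subseteq> {..<n} \<and> card I = k \<longrightarrow> plucker n k L I = c * row_minor A I)"
proof -
  define B where "B = (SOME A. basis_matrix n k L A)"
  have B: "basis_matrix n k L B"
    unfolding B_def using someI_ex[OF basis_matrix_exists[OF L]] .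
  have Ac: "A \<in> carrier_mat n k" and Bc: "B \<in> carrier_mat n k"
    using A B by (auto simp: basis_matrix_def)
  obtain C D where C: "C \<in> carrier_mat k k" "B = A * C"
    and D: "D \<in> carrier_mat k k" "A = B * D"
    using basis_matrix_change[OF L] A B by metis
  have CD: "C * D \<in> carrier_mat k k" using C D by simp
  have e: "A * (C * D) = A"
    using assoc_mult_mat[OF Ac C(1) D(1)] by (simp only: C(2)[symmetric] D(2)[symmetric])
  have "C * D = 1\<^sub>m k"
  proof (rule mat_col_eqI)
    fix j assume "j < dim_col (1\<^sub>m k :: complex mat)"
    then have j: "j < k" by simp
    let ?x = "col (C * D) j" and ?u = "unit_vec k j :: complex vec"
    have xc: "?x \<in> carrier_vec k" using CD by (metis col_dim carrier_matD(1))
    have "A *\<^sub>v ?x = col A j" using col_mult2[OF Ac CD j] e by simp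
    also have "col A j = A *\<^sub>v ?u" using Ac j by (intro eq_vecI) auto
    finally have "A *\<^sub>v (?x - ?u) = 0\<^sub>v n"
      using mult_minus_distrib_mat_vec[OF Ac xc, of ?u] Ac by simp
    then have z: "?x - ?u = 0\<^sub>v k"
      by (intro basis_matrix_span(2)[OF L A]) (use xc in auto)
    have "?x = ?u"
    proof (rule eq_vecI)
      fix i assume i: "i < dim_vec ?u"
      have "(?x - ?u) $ i = 0" using z i by simp
      then show "?x $ i = ?u $ i" using i xc by simp
    qed (use C(1) xc in simp)
    then show "?x = col (1\<^sub>m k) j" using j by simp
  qed (use C(1) D(1) in auto)
  then have "det C * det D = 1" using det_mult[OF C(1) D(1)] by simp
  then have "det C \<noteq> 0" by auto
  moreover have "plucker n k L I = det C * row_minor A I" if "I \<subseteq> {..<n}" "card I = k" for I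
    using row_minor_mult[OF Ac C(1) that] C(2) by (simp add: plucker_def flip: B_def)
  ultimately show ?thesis by blast
qed


text \<open>The torus is \<open>(\<complex>\<^sup>*)\<^sup>n\<close>, and it acts on the Grassmannian.\<close>

lemma carrier_torus: "carrier (torus n) = (\<Pi>\<^sub>E i\<in>{..<n}. - {0})"
  by (force simp: torus_def units_of_def Units_def class_ring_simps intro!: PiE_cong
      intro: right_inverse)

lemma mult_torus: "s \<otimes>\<^bsub>torus n\<^esub> t = (\<lambda>i\<in>{..<n}. s i * t i)"
  by (simp add: torus_def units_of_def class_ring_simps)

lemma one_torus: "\<one>\<^bsub>torus n\<^esub> = (\<lambda>i\<in>{..<n}. 1)"
  by (simp add: torus_def units_of_def class_ring_simps)

lemma group_torus: "group (torus n)"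
proof -
  interpret F: Ring.field "class_ring :: complex ring" by (rule class_field)
  have "Group.monoid (class_ring :: complex ring)" by unfold_locales
  then show ?thesis unfolding torus_def by (intro product_group Group.monoid.units_group)
qed

lemma coord_action_mult:
  "v \<in> carrier_vec n \<Longrightarrow>
    coord_action n (s \<otimes>\<^bsub>torus n\<^esub> t) v = coord_action n s (coord_action n t v)"
  by (auto simp: coord_action_def mult_torus intro!: eq_vecI)

lemma coord_action_one: "v \<in> carrier_vec n \<Longrightarrow> coord_action n \<one>\<^bsub>torus n\<^esub> v = v"
  by (auto simp: coord_action_def one_torus intro!: eq_vecI)

lemma coord_action_inj:
  assumes "t \<in> carrier (torus n)"
  shows "inj_on (coord_action n t) (carrier_vec n)"
proof (intro inj_onI eq_vecI)
  fix v w i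
  assume "coord_action n t v = coord_action n t w" "v \<in> carrier_vec n" "w \<in> carrier_vec n"
    "i < dim_vec w"
  then have "coord_action n t v $ i = coord_action n t w $ i" and "i < n" by auto
  with assms show "v $ i = w $ i" by (auto simp: coord_action_def carrier_torus)
qed auto

lemma torus_action_closed:
  assumes t: "t \<in> carrier (torus n)" and L: "L \<in> grassmannian n k"
  shows "coord_action n t ` L \<in> grassmannian n k"
proof -
  let ?f = "coord_action n t" and ?M = "coord_action n t ` L"
  interpret V: vec_space "TYPE(complex)" n .
  interpret W: vectorspace class_ring "(cspace n)\<lparr>carrier := L\<rparr>"
    using grassmannianD(2)[OF L] .
  have sm: "LinearCombinations.submodule class_ring L (cspace n)"
    using grassmannianD(1)[OF L] unfolding VectorSpace.subspace_def by auto
  have Lc: "L \<subseteq> carrier_vec n" by (rule grassmannianD(4)[OF L])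
  have add: "?f (v + w) = ?f v + ?f w" if "v \<in> carrier_vec n" "w \<in> carrier_vec n" for v w
    using that by (auto simp: coord_action_def algebra_simps intro!: eq_vecI)
  have smult: "?f (c \<cdot>\<^sub>v v) = c \<cdot>\<^sub>v ?f v" if "v \<in> carrier_vec n" for c v
    using that by (auto simp: coord_action_def intro!: eq_vecI)
  have zero: "?f (0\<^sub>v n) = 0\<^sub>v n"
    by (auto simp: coord_action_def intro!: eq_vecI)
  have L_add: "v + w \<in> L" if "v \<in> L" "w \<in> L" for v w
    using LinearCombinations.submodule.m_closed[OF sm that] by simp
  have L_smult: "c \<cdot>\<^sub>v v \<in> L" if "v \<in> L" for c v
    using LinearCombinations.submodule.smult_closed[OF sm _ that, of c] by simp
  have L_zero: "0\<^sub>v n \<in> L"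
    using LinearCombinations.submodule.zero_closed[OF sm] by simp
  have "LinearCombinations.submodule class_ring ?M (cspace n)"
  proof (rule LinearCombinations.submodule.intro)
    show "Module.module class_ring (cspace n)" by (rule vec_module)
    show "?M \<subseteq> carrier (cspace n)" by (auto simp: coord_action_def)
    show "\<zero>\<^bsub>cspace n\<^esub> \<in> ?M" using zero L_zero by (metis V.cV image_eqI module_vec_simps(2))
  next
    fix v w assume "v \<in> ?M" "w \<in> ?M"
    then obtain v' w' where *: "v' \<in> L" "w' \<in> L" "v = ?f v'" "w = ?f w'" by auto
    then have "v + w = ?f (v' + w')" using add[of v' w'] Lc by (simp add: subset_iff)
    then show "v \<oplus>\<^bsub>cspace n\<^esub> w \<in> ?M" using L_add *(1,2) by (simp add: module_vec_simps)
  next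
    fix c v assume "v \<in> ?M"
    then obtain v' where *: "v' \<in> L" "v = ?f v'" by auto
    then have "c \<cdot>\<^sub>v v = ?f (c \<cdot>\<^sub>v v')" using smult Lc by auto
    then show "c \<odot>\<^bsub>cspace n\<^esub> v \<in> ?M" using L_smult *(1) by (simp add: module_vec_simps)
  qed
  then have sub: "VectorSpace.subspace class_ring ?M (cspace n)"
    using vec_vs by (simp add: VectorSpace.subspace_def)
  interpret M: vectorspace class_ring "(cspace n)\<lparr>carrier := ?M\<rparr>"
    using V.subspace_is_vs[OF sub] .
  have "?f \<in> LinearCombinations.module_hom class_ring ((cspace n)\<lparr>carrier := L\<rparr>)
      ((cspace n)\<lparr>carrier := ?M\<rparr>)"
    using Lc by (auto simp: LinearCombinations.module_hom_def module_vec_simps subset_iff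
        intro!: add smult)
  then interpret T: linear_map class_ring "(cspace n)\<lparr>carrier := L\<rparr>"
    "(cspace n)\<lparr>carrier := ?M\<rparr>" ?f
    by unfold_locales
  have "W.dim = M.dim"
    by (rule T.dim_eq[OF subspace_fin_dim[OF grassmannianD(1)[OF L]]])
      (use coord_action_inj[OF t] Lc in \<open>auto intro: inj_on_subset\<close>)
  then show ?thesis
    using sub grassmannianD(3)[OF L] by (simp add: grassmannian_def)
qed

lemma group_action_torus: "group_action (torus n) (grassmannian n k) (torus_action n k)"
proof -
  let ?G = "grassmannian n k" and ?\<phi> = "torus_action n k"
  interpret group "torus n" by (rule group_torus)
  have mult: "?\<phi> (s \<otimes>\<^bsub>torus n\<^esub> t) L = ?\<phi> s (?\<phi> t L)"
    if "s \<in> carrier (torus n)" "t \<in> carrier (torus n)" "L \<in> ?G" for s t L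
    using that grassmannianD(4)[OF that(3)] torus_action_closed
    by (auto simp: torus_action_def image_image coord_action_mult subset_iff
        intro!: image_cong)
  have one: "?\<phi> \<one>\<^bsub>torus n\<^esub> L = L" if "L \<in> ?G" for L
  proof -
    have "coord_action n \<one>\<^bsub>torus n\<^esub> ` L = id ` L"
      using grassmannianD(4)[OF that] by (intro image_cong) (auto simp: coord_action_one)
    then show ?thesis using that by (simp add: torus_action_def)
  qed
  have closed: "?\<phi> t L \<in> ?G" if "t \<in> carrier (torus n)" "L \<in> ?G" for t L
    using torus_action_closed[OF that] that by (simp add: torus_action_def)
  have bij: "?\<phi> t \<in> Bij ?G" if t: "t \<in> carrier (torus n)" for t
  proof -
    have "bij_betw (?\<phi> t) ?G ?G"
      by (rule bij_betw_byWitness[where f' = "?\<phi> (inv\<^bsub>torus n\<^esub> t)"])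
        (use t closed one in \<open>auto simp flip: mult\<close>)
    then show ?thesis by (auto simp: Bij_def torus_action_def)
  qed
  show ?thesis
    unfolding group_action_def
  proof (intro group_hom.intro group_hom_axioms.intro group_BijGroup group_torus)
    show "?\<phi> \<in> hom (torus n) (BijGroup ?G)"
    proof (rule homI)
      fix s t assume st: "s \<in> carrier (torus n)" "t \<in> carrier (torus n)"
      have "?\<phi> (s \<otimes>\<^bsub>torus n\<^esub> t) = compose ?G (?\<phi> s) (?\<phi> t)"
        using mult[OF st] by (auto simp: compose_def torus_action_def fun_eq_iff)
      then show "?\<phi> (s \<otimes>\<^bsub>torus n\<^esub> t) = ?\<phi> s \<otimes>\<^bsub>BijGroup ?G\<^esub> ?\<phi> t"
        using bij st by (simp add: BijGroup_def)
    qed (use bij in \<open>simp add: BijGroup_def\<close>)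
  qed
qed

end

theory Submission
  imports Defs
begin

text \<open>The minor \<open>P\<^sup>I(L)\<close> is nonzero iff no nonzero vector of \<open>L\<close> vanishes on \<open>I\<close>. Fix \<open>J \<in> \<sigma>\<close>. For
  \<open>j \<in> J\<close> the vectors of \<open>L\<close> vanishing on \<open>J - {j}\<close> form a line, spanned by some \<open>u\<^sub>j\<close>, and
  \<open>u\<^sub>j $ i \<noteq> 0\<close> iff \<open>J - {j} \<union> {i} \<in> \<sigma>\<close>. The \<open>u\<^sub>j\<close> span \<open>L\<close>, so \<open>t\<close> stabilizes \<open>L\<close> iff it scales
  every \<open>u\<^sub>j\<close>, that is, iff \<open>t i = t j\<close> whenever \<open>J - {j} \<union> {i} \<in> \<sigma>\<close>: a condition on \<open>\<sigma>\<close> only.\<close>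

section \<open>Minors and injectivity of coordinate projections\<close>

text \<open>Padding \<open>B\<close> with zero rows gives a singular square matrix, to which the
  determinant criterion for a nonzero kernel vector applies.\<close>

lemma wide_mat_kernel:
  fixes B :: "'a :: field mat"
  assumes B: "B \<in> carrier_mat m k" and "m < k"
  shows "\<exists>x \<in> carrier_vec k. x \<noteq> 0\<^sub>v k \<and> B *\<^sub>v x = 0\<^sub>v m"
proof -
  define C where "C = mat k k (\<lambda>(i, j). if i < m then B $$ (i, j) else 0)"
  have C: "C \<in> carrier_mat k k" by (simp add: C_def)
  \<comment> \<open>Row \<open>m\<close> of \<open>C\<close> is a padding row, so the transpose
    kills this unit vector. The determinant criterion is used twice: here on the transpose to get
    \<open>det C = 0\<close>, then on \<open>C\<close> to get \<open>x\<close>.\<close>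
  have "C\<^sup>T *\<^sub>v unit_vec k m = 0\<^sub>v k"
    using \<open>m < k\<close> by (intro eq_vecI) (auto simp: C_def)
  moreover have "unit_vec k m \<noteq> (0\<^sub>v k :: 'a vec)"
    using \<open>m < k\<close> by (metis index_unit_vec(2) index_zero_vec(1) zero_neq_one)
  ultimately have "det C\<^sup>T = 0"
    using C by (subst det_0_iff_vec_prod_zero[of _ k]) (auto intro!: exI[of _ "unit_vec k m"])
  then have "det C = 0" using det_transpose[OF C] by simp
  then obtain x where x: "x \<in> carrier_vec k" "x \<noteq> 0\<^sub>v k" "C *\<^sub>v x = 0\<^sub>v k"
    using det_0_iff_vec_prod_zero[OF C] by blast
  have "B *\<^sub>v x = 0\<^sub>v m"
  proof (rule eq_vecI)
    fix i assume "i < dim_vec (0\<^sub>v m :: 'a vec)"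
    then have i: "i < m" by simp
    then have "row B i = row C i"
      using B \<open>m < k\<close> by (intro eq_vecI) (auto simp: C_def)
    then have "(B *\<^sub>v x) $ i = (C *\<^sub>v x) $ i"
      using B C i \<open>m < k\<close> by simp
    then show "(B *\<^sub>v x) $ i = 0\<^sub>v m $ i" using x(3) i \<open>m < k\<close> by simp
  qed (use B in auto)
  with x show ?thesis by blast
qed

lemma submatrix_UNIV_carrier:
  assumes "A \<in> carrier_mat n k" and "I \<subseteq> {..<n}"
  shows "submatrix A I UNIV \<in> carrier_mat (card I) k"
proof -
  have "{i. i < n \<and> i \<in> I} = I" using assms(2) by auto
  then show ?thesis using assms(1) by (auto simp: submatrix_def)
qed

text \<open>Row \<open>a\<close> of the submatrix is row \<open>pick I a\<close> of
  \<open>A\<close>, and \<open>pick I\<close> enumerates \<open>I\<close>. When \<open>A\<close> is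
  a basis matrix of \<open>L\<close>, kernel vectors of the submatrix thus correspond to vectors of
  \<open>L\<close> vanishing on \<open>I\<close>.\<close>

lemma submatrix_mult_vec_eq_0_iff:
  fixes A :: "'a :: semiring_0 mat"
  assumes A: "A \<in> carrier_mat n k" and I: "I \<subseteq> {..<n}" and x: "x \<in> carrier_vec k"
  shows "submatrix A I UNIV *\<^sub>v x = 0\<^sub>v (card I) \<longleftrightarrow> (\<forall>i\<in>I. (A *\<^sub>v x) $ i = 0)"
proof -
  have cI: "{i. i < n \<and> i \<in> I} = I" using I by auto
  have fin: "finite I" using I finite_subset by blast
  note S = submatrix_UNIV_carrier[OF A I]
  have pick: "pick I a \<in> I" if "a < card I" for a
    using pick_in_set_le[OF that] .
  \<comment> \<open>The position of \<open>i\<close> in the increasing enumeration of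
    \<open>I\<close>, counted from 0, is the number of elements of \<open>I\<close> below
    \<open>i\<close>.\<close>
  have ex: "\<exists>a < card I. pick I a = i" if "i \<in> I" for i
  proof (intro exI conjI)
    show "pick I (card {a\<in>I. a < i}) = i" using that by (rule pick_card_in_set)
    show "card {a\<in>I. a < i} < card I" using that by (intro psubset_card_mono fin) auto
  qed
  have eq: "(submatrix A I UNIV *\<^sub>v x) $ a = (A *\<^sub>v x) $ pick I a" if a: "a < card I" for a
  proof -
    have "row (submatrix A I UNIV) a = row A (pick I a)"
      using A S a cI pick[OF a] I
      by (intro eq_vecI) (auto simp: submatrix_def pick_UNIV)
    then show ?thesis using A S a pick[OF a] I by auto
  qed
  show ?thesis
  proof
    assume 0: "submatrix A I UNIV *\<^sub>v x = 0\<^sub>v (card I)"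
    show "\<forall>i\<in>I. (A *\<^sub>v x) $ i = 0"
    proof
      fix i assume "i \<in> I"
      then obtain a where "a < card I" "pick I a = i" using ex by blast
      then show "(A *\<^sub>v x) $ i = 0" using eq 0 by force
    qed
  qed (use S eq pick in \<open>auto intro!: eq_vecI\<close>)
qed

text \<open>Vanishing on \<open>I\<close> is a system of fewer than \<open>k\<close> homogeneous
  linear equations in the \<open>k\<close> coefficients with respect to a basis of
  \<open>L\<close>.\<close>

lemma grassmannian_vanishing_vector:
  assumes L: "L \<in> grassmannian n k" and I: "I \<subseteq> {..<n}" "card I < k"
  shows "\<exists>v \<in> L. v \<noteq> 0\<^sub>v n \<and> (\<forall>i\<in>I. v $ i = 0)"
proof -
  obtain A where A: "basis_matrix n k L A" using basis_matrix_exists[OF L] ..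
  then have Ac: "A \<in> carrier_mat n k" by (simp add: basis_matrix_def)
  obtain x where x: "x \<in> carrier_vec k" "x \<noteq> 0\<^sub>v k" "submatrix A I UNIV *\<^sub>v x = 0\<^sub>v (card I)"
    using wide_mat_kernel[OF submatrix_UNIV_carrier[OF Ac I(1)] I(2)] by blast
  have "A *\<^sub>v x \<in> L" using basis_matrix_span(1)[OF L A] x(1) by blast
  moreover have "A *\<^sub>v x \<noteq> 0\<^sub>v n" using basis_matrix_span(2)[OF L A x(1)] x(2) by blast
  ultimately show ?thesis
    using submatrix_mult_vec_eq_0_iff[OF Ac I(1) x(1)] x(3) by blast
qed

text \<open>A square matrix has nonzero determinant iff its kernel is trivial, and multiplication by
  a basis matrix carries this kernel bijectively to the vectors of \<open>L\<close> vanishing on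
  \<open>I\<close>. The criterion no longer mentions the chosen basis matrix.\<close>

lemma plucker_nonzero_iff:
  assumes L: "L \<in> grassmannian n k" and I: "I \<subseteq> {..<n}" "card I = k"
  shows "plucker n k L I \<noteq> 0 \<longleftrightarrow> (\<forall>v\<in>L. (\<forall>i\<in>I. v $ i = 0) \<longrightarrow> v = 0\<^sub>v n)"
proof -
  obtain A where A: "basis_matrix n k L A" using basis_matrix_exists[OF L] ..
  then have Ac: "A \<in> carrier_mat n k" by (simp add: basis_matrix_def)
  have S: "submatrix A I UNIV \<in> carrier_mat k k"
    using submatrix_UNIV_carrier[OF Ac I(1)] I(2) by simp
  have kernel: "submatrix A I UNIV *\<^sub>v x = 0\<^sub>v k \<longleftrightarrow> (\<forall>i\<in>I. (A *\<^sub>v x) $ i = 0)"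
    if "x \<in> carrier_vec k" for x
    using submatrix_mult_vec_eq_0_iff[OF Ac I(1) that] I(2) by simp
  have zero: "x = 0\<^sub>v k \<longleftrightarrow> A *\<^sub>v x = 0\<^sub>v n" if "x \<in> carrier_vec k" for x
  proof
    assume "x = 0\<^sub>v k"
    then show "A *\<^sub>v x = 0\<^sub>v n" using Ac by (auto intro!: eq_vecI)
  qed (rule basis_matrix_span(2)[OF L A that])
  have "plucker n k L I \<noteq> 0 \<longleftrightarrow> row_minor A I \<noteq> 0"
    using plucker_proportional[OF L A] I by auto
  also have "\<dots> \<longleftrightarrow> (\<forall>x\<in>carrier_vec k. submatrix A I UNIV *\<^sub>v x = 0\<^sub>v k \<longrightarrow> x = 0\<^sub>v k)"
    unfolding row_minor_def det_0_iff_vec_prod_zero[OF S] by blast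
  also have "\<dots> \<longleftrightarrow> (\<forall>x\<in>carrier_vec k. (\<forall>i\<in>I. (A *\<^sub>v x) $ i = 0) \<longrightarrow> A *\<^sub>v x = 0\<^sub>v n)"
    using kernel zero by simp
  also have "\<dots> \<longleftrightarrow> (\<forall>v\<in>L. (\<forall>i\<in>I. v $ i = 0) \<longrightarrow> v = 0\<^sub>v n)"
    unfolding basis_matrix_span(1)[OF L A, symmetric] by blast
  finally show ?thesis .
qed

text \<open>A minimal \<open>I\<close> such that \<open>L \<rightarrow> \<complex>\<^sup>I\<close> is injective has exactly \<open>k\<close> elements: by
  minimality there are \<open>u\<^sub>i \<in> L\<close> whose restrictions to \<open>I\<close> are nonzero multiples of the unit vectors.\<close>

lemma ex_plucker_nonzero:
  assumes L: "L \<in> grassmannian n k"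
  shows "\<exists>I. I \<subseteq> {..<n} \<and> card I = k \<and> plucker n k L I \<noteq> 0"
proof -
  obtain A where A: "basis_matrix n k L A" using basis_matrix_exists[OF L] ..
  then have Ac: "A \<in> carrier_mat n k" by (simp add: basis_matrix_def)
  let ?P = "\<lambda>I. I \<subseteq> {..<n} \<and> (\<forall>v\<in>L. (\<forall>i\<in>I. v $ i = 0) \<longrightarrow> v = 0\<^sub>v n)"
  \<comment> \<open>The full index set satisfies \<open>?P\<close>, so a set of least cardinality
    with this property exists.\<close>
  have "?P {..<n}" using grassmannianD(4)[OF L] by (auto intro!: eq_vecI)
  then obtain I where I: "?P I" and min: "\<And>I'. ?P I' \<Longrightarrow> card I \<le> card I'"
    using ex_has_least_nat[of ?P "{..<n}" card] by blast
  have fin: "finite I" using I finite_subset by blast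
  have "k \<le> card I"
    using grassmannian_vanishing_vector[OF L, of I] I by (metis not_less)
  moreover have "card I \<le> k"
  proof (rule ccontr)
    assume "\<not> card I \<le> k"
    then have less: "k < card I" by simp
    have "\<exists>x \<in> carrier_vec k. (A *\<^sub>v x) $ i \<noteq> 0 \<and> (\<forall>i'\<in>I - {i}. (A *\<^sub>v x) $ i' = 0)"
      if i: "i \<in> I" for i
    proof -
      have "\<not> ?P (I - {i})"
        using min[of "I - {i}"] card_Diff1_less[OF fin i] by linarith
      then obtain v where v: "v \<in> L" "\<forall>i'\<in>I - {i}. v $ i' = 0" "v \<noteq> 0\<^sub>v n" using I by blast
      then have "v $ i \<noteq> 0" using I by blast
      with v basis_matrix_span(1)[OF L A] show ?thesis by blast
    qed
    then obtain x where x: "\<And>i. i \<in> I \<Longrightarrow> x i \<in> carrier_vec k"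
      "\<And>i. i \<in> I \<Longrightarrow> (A *\<^sub>v x i) $ i \<noteq> 0"
      "\<And>i i'. i \<in> I \<Longrightarrow> i' \<in> I \<Longrightarrow> i' \<noteq> i \<Longrightarrow> (A *\<^sub>v x i) $ i' = 0"
      by (metis Diff_iff singletonD)
    obtain xs where xs: "set xs = I" "distinct xs" using finite_distinct_list[OF fin] by blast
    have len: "length xs = card I" using xs distinct_card by fastforce
    \<comment> \<open>\<open>X\<close> has more columns than rows, hence a nonzero kernel vector
      \<open>y\<close>. But the rows of \<open>A * X\<close> indexed by \<open>I\<close> form, in
      the order \<open>xs\<close>, a diagonal matrix with nonzero diagonal, which forces
      \<open>y\<close> to be zero.\<close>
    define X where "X = mat_of_cols k (map x xs)"
    have X: "X \<in> carrier_mat k (card I)" by (simp add: X_def len[symmetric] carrier_matI)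
    obtain y where y: "y \<in> carrier_vec (card I)" "y \<noteq> 0\<^sub>v (card I)" "X *\<^sub>v y = 0\<^sub>v k"
      using wide_mat_kernel[OF X less] by blast
    have AX: "A * X \<in> carrier_mat n (card I)" using Ac X by simp
    have entry: "(A * X) $$ (xs ! a, b) = (A *\<^sub>v x (xs ! b)) $ (xs ! a)"
      if "a < card I" "b < card I" for a b
    proof -
      have "xs ! a < n" "xs ! b \<in> I" using that I xs len nth_mem[of _ xs] by auto
      moreover have "col X b = x (xs ! b)"
        unfolding X_def using that len x(1)[OF \<open>xs ! b \<in> I\<close>] by (subst col_mat_of_cols) auto
      ultimately show ?thesis using Ac X that by simp
    qed
    have "y $ a = 0" if a: "a < card I" for a
    proof -
      have ia: "xs ! a \<in> I" "xs ! a < n" using a I xs len nth_mem[of a xs] by auto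
      have "(A * X) *\<^sub>v y = A *\<^sub>v (X *\<^sub>v y)"
        using assoc_mult_mat_vec[OF Ac X y(1)] .
      also have "\<dots> = 0\<^sub>v n" using y(3) Ac by (auto intro!: eq_vecI)
      finally have "0 = ((A * X) *\<^sub>v y) $ (xs ! a)" using ia by simp
      also have "\<dots> = (\<Sum>b = 0..<card I. (A * X) $$ (xs ! a, b) * y $ b)"
        using AX y(1) ia by (auto simp: scalar_prod_def simp del: index_mult_mat intro!: sum.cong)
      also have "\<dots> = (\<Sum>b = 0..<card I. if b = a then (A *\<^sub>v x (xs ! a)) $ (xs ! a) * y $ a else 0)"
      proof (intro sum.cong refl)
        fix b assume b: "b \<in> {0..<card I}"
        have "xs ! b \<in> I" using b xs len nth_mem[of b xs] by auto
        moreover have "xs ! a \<noteq> xs ! b" if "b \<noteq> a"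
          using that a b len xs(2) by (simp add: nth_eq_iff_index_eq)
        ultimately show "(A * X) $$ (xs ! a, b) * y $ b
            = (if b = a then (A *\<^sub>v x (xs ! a)) $ (xs ! a) * y $ a else 0)"
          using entry[OF a, of b] b ia x(3)[of "xs ! b" "xs ! a"] by simp
      qed
      also have "\<dots> = (A *\<^sub>v x (xs ! a)) $ (xs ! a) * y $ a" using a by simp
      finally show ?thesis using x(2)[OF ia(1)] by simp
    qed
    then have "y = 0\<^sub>v (card I)" using y(1) by (intro eq_vecI) auto
    with y(2) show False ..
  qed
  ultimately have "card I = k" by simp
  with I plucker_nonzero_iff[OF L] show ?thesis by blast
qed

section \<open>The stabilizer of a point of a stratum\<close>

lemma grassmannian_closed:
  assumes L: "L \<in> grassmannian n k"
  shows "0\<^sub>v n \<in> L"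
    and "\<And>v w. v \<in> L \<Longrightarrow> w \<in> L \<Longrightarrow> v + w \<in> L"
    and "\<And>c v. v \<in> L \<Longrightarrow> c \<cdot>\<^sub>v v \<in> L"
proof -
  have sm: "LinearCombinations.submodule class_ring L (cspace n)"
    using grassmannianD(1)[OF L] unfolding VectorSpace.subspace_def by auto
  show "0\<^sub>v n \<in> L" using LinearCombinations.submodule.zero_closed[OF sm] by (simp add: module_vec_simps)
  show "v + w \<in> L" if "v \<in> L" "w \<in> L" for v w
    using LinearCombinations.submodule.m_closed[OF sm that] by (simp add: module_vec_simps)
  show "c \<cdot>\<^sub>v v \<in> L" if "v \<in> L" for c v
    using LinearCombinations.submodule.smult_closed[OF sm _ that, of c] by (simp add: module_vec_simps)
qed

text \<open>The \<open>u\<close> for varying \<open>j\<close> form the basis of \<open>L\<close>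
  dual to the coordinates in \<open>J\<close>. Up to sign, \<open>u $ i\<close> is the ratio of the
  coordinate at the exchanged set to the one at \<open>J\<close>; only the vanishing of this ratio
  is tracked.\<close>

lemma grassmannian_exchange_basis:
  assumes L: "L \<in> grassmannian n k"
    and J: "J \<subseteq> {..<n}" "card J = k" "plucker n k L J \<noteq> 0" and j: "j \<in> J"
  obtains u where "u \<in> L" "u $ j = 1" "\<And>i. i \<in> J \<Longrightarrow> i \<noteq> j \<Longrightarrow> u $ i = 0"
    "\<And>i. i < n \<Longrightarrow> i \<notin> J \<Longrightarrow> u $ i \<noteq> 0 \<longleftrightarrow> plucker n k L (insert i (J - {j})) \<noteq> 0"
proof -
  note inj = plucker_nonzero_iff[OF L J(1,2), THEN iffD1, OF J(3), rule_format]
  have fin: "finite J" using J(1) finite_subset by blast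
  have jn: "j < n" using j J(1) by auto
  have "card (J - {j}) < k" using card_Diff1_less[OF fin j] J(2) by simp
  then obtain v where v: "v \<in> L" "v \<noteq> 0\<^sub>v n" "\<And>i. i \<in> J - {j} \<Longrightarrow> v $ i = 0"
    using grassmannian_vanishing_vector[OF L, of "J - {j}"] J(1) by blast
  \<comment> \<open>Otherwise \<open>v\<close> would vanish on all of \<open>J\<close>. Hence
    \<open>v\<close> can be rescaled to have \<open>j\<close>-th coordinate 1.\<close>
  have vj: "v $ j \<noteq> 0" using inj[of v] v by blast
  have Lc: "w \<in> carrier_vec n" if "w \<in> L" for w using grassmannianD(4)[OF L] that by auto
  define u where "u = (1 / v $ j) \<cdot>\<^sub>v v"
  have u: "u \<in> L" "u $ j = 1" "\<And>i. i \<in> J \<Longrightarrow> i \<noteq> j \<Longrightarrow> u $ i = 0"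
    using v vj Lc[OF v(1)] grassmannian_closed(3)[OF L] jn J(1) by (auto simp: u_def)
  have "u $ i \<noteq> 0 \<longleftrightarrow> plucker n k L (insert i (J - {j})) \<noteq> 0" if i: "i < n" "i \<notin> J" for i
  proof -
    have "card (insert i (J - {j})) = k"
      using card.remove[OF fin j] fin i J(2) by simp
    then have "plucker n k L (insert i (J - {j})) \<noteq> 0
        \<longleftrightarrow> (\<forall>w\<in>L. (\<forall>i'\<in>insert i (J - {j}). w $ i' = 0) \<longrightarrow> w = 0\<^sub>v n)"
      using i J(1) by (intro plucker_nonzero_iff[OF L]) auto
    also have "\<dots> \<longleftrightarrow> u $ i \<noteq> 0"
    proof
      assume "\<forall>w\<in>L. (\<forall>i'\<in>insert i (J - {j}). w $ i' = 0) \<longrightarrow> w = 0\<^sub>v n"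
      moreover have "u \<noteq> 0\<^sub>v n" using u(2) jn by auto
      ultimately show "u $ i \<noteq> 0" using u by blast
    next
      assume ui: "u $ i \<noteq> 0"
      show "\<forall>w\<in>L. (\<forall>i'\<in>insert i (J - {j}). w $ i' = 0) \<longrightarrow> w = 0\<^sub>v n"
      proof (intro ballI impI)
        fix w assume w: "w \<in> L" "\<forall>i'\<in>insert i (J - {j}). w $ i' = 0"
        \<comment> \<open>Off \<open>j\<close> both \<open>w\<close> and \<open>u\<close> vanish on
          \<open>J\<close>, and at \<open>j\<close> the terms cancel. So \<open>?d\<close> is zero
          and \<open>w\<close> is a multiple of \<open>u\<close>; coordinate \<open>i\<close> then
          shows that the factor is 0.\<close>
        let ?d = "w + (- w $ j) \<cdot>\<^sub>v u"
        have dL: "?d \<in> L" using w(1) u(1) grassmannian_closed[OF L] by blast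
        have d: "?d $ i' = w $ i' - w $ j * u $ i'" if "i' < n" for i'
          using that Lc[OF w(1)] Lc[OF u(1)] by simp
        have "?d $ i' = 0" if "i' \<in> J" for i'
        proof -
          have "i' < n" using that J(1) by auto
          then show ?thesis using d w(2) u that by (cases "i' = j") auto
        qed
        then have "?d = 0\<^sub>v n" using inj[OF dL] by blast
        then have eq: "w $ i' = w $ j * u $ i'" if "i' < n" for i' using d[OF that] that by simp
        have "w $ j = 0" using eq[OF i(1)] w(2) ui by simp
        then show "w = 0\<^sub>v n" using eq Lc[OF w(1)] by (intro eq_vecI) auto
      qed
    qed
    finally show ?thesis by blast
  qed
  with u that show thesis by blast
qed

text \<open>Both sides say that every dual basis vector \<open>u j\<close> is an eigenvector of
  \<open>t\<close> with eigenvalue \<open>t j\<close>, since the support of \<open>u j\<close>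
  outside \<open>J\<close> is read off from the exchanged sets.\<close>

lemma coord_action_subset_iff:
  assumes L: "L \<in> grassmannian n k"
    and J: "J \<subseteq> {..<n}" "card J = k" "plucker n k L J \<noteq> 0"
  shows "coord_action n t ` L \<subseteq> L \<longleftrightarrow>
    (\<forall>j\<in>J. \<forall>i\<in>{..<n} - J. plucker n k L (insert i (J - {j})) \<noteq> 0 \<longrightarrow> t i = t j)"
    (is "_ \<longleftrightarrow> ?R")
proof -
  note inj = plucker_nonzero_iff[OF L J(1,2), THEN iffD1, OF J(3), rule_format]
  note closed = grassmannian_closed[OF L]
  have fin: "finite J" using J(1) finite_subset by blast
  have Lc: "w \<in> carrier_vec n" if "w \<in> L" for w using grassmannianD(4)[OF L] that by auto
  have "\<exists>u. u \<in> L \<and> u $ j = 1 \<and> (\<forall>i\<in>J. i \<noteq> j \<longrightarrow> u $ i = 0) \<and>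
      (\<forall>i<n. i \<notin> J \<longrightarrow> (u $ i \<noteq> 0 \<longleftrightarrow> plucker n k L (insert i (J - {j})) \<noteq> 0))"
    if "j \<in> J" for j
    using grassmannian_exchange_basis[OF L J that] by metis
  then have "\<exists>u. \<forall>j\<in>J. u j \<in> L \<and> u j $ j = 1 \<and> (\<forall>i\<in>J. i \<noteq> j \<longrightarrow> u j $ i = 0) \<and>
      (\<forall>i<n. i \<notin> J \<longrightarrow> (u j $ i \<noteq> 0 \<longleftrightarrow> plucker n k L (insert i (J - {j})) \<noteq> 0))"
    by (intro bchoice) blast
  then obtain u where u: "\<And>j. j \<in> J \<Longrightarrow> u j \<in> L" "\<And>j. j \<in> J \<Longrightarrow> u j $ j = 1"
    "\<And>j i. j \<in> J \<Longrightarrow> i \<in> J \<Longrightarrow> i \<noteq> j \<Longrightarrow> u j $ i = 0"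
    "\<And>j i. j \<in> J \<Longrightarrow> i < n \<Longrightarrow> i \<notin> J \<Longrightarrow>
      u j $ i \<noteq> 0 \<longleftrightarrow> plucker n k L (insert i (J - {j})) \<noteq> 0"
    by blast
  show ?thesis
  proof
    assume sub: "coord_action n t ` L \<subseteq> L"
    show ?R
    proof (intro ballI impI)
      fix j i assume j: "j \<in> J" and i: "i \<in> {..<n} - J"
        and nz: "plucker n k L (insert i (J - {j})) \<noteq> 0"
      \<comment> \<open>This is the defect of \<open>u j\<close> from being an eigenvector. It lies
        in \<open>L\<close> and vanishes on \<open>J\<close>, so it is zero.\<close>
      let ?d = "coord_action n t (u j) + (- t j) \<cdot>\<^sub>v u j"
      have dL: "?d \<in> L" using sub u(1)[OF j] closed by blast
      have d: "?d $ i' = (t i' - t j) * u j $ i'" if "i' < n" for i'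
        using that Lc[OF u(1)[OF j]] by (simp add: coord_action_def algebra_simps)
      have "?d $ i' = 0" if "i' \<in> J" for i'
      proof -
        have "i' < n" using that J(1) by auto
        then show ?thesis using d u(3)[OF j that] by (cases "i' = j") auto
      qed
      then have "?d = 0\<^sub>v n" using inj[OF dL] by blast
      then have "(t i - t j) * u j $ i = 0" using d[of i] i by simp
      then show "t i = t j" using u(4)[OF j] i nz by auto
    qed
  next
    assume R: ?R
    have tu: "coord_action n t (u j) = t j \<cdot>\<^sub>v u j" if j: "j \<in> J" for j
    proof (rule eq_vecI)
      fix i assume "i < dim_vec (t j \<cdot>\<^sub>v u j)"
      then have i: "i < n" using Lc[OF u(1)[OF j]] by simp
      have "u j $ i = 0 \<or> t i = t j"
        using R j i u(3,4)[OF j, of i] by (cases "i \<in> J") auto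
      then show "coord_action n t (u j) $ i = (t j \<cdot>\<^sub>v u j) $ i"
        using i Lc[OF u(1)[OF j]] by (auto simp: coord_action_def)
    qed (use Lc[OF u(1)[OF j]] in \<open>simp add: coord_action_def\<close>)
    \<comment> \<open>Instead of expanding \<open>v\<close> in the \<open>u j\<close>, the induction
      clears one nonzero coordinate in \<open>J\<close> at a time by subtracting
      \<open>v $ j\<close> times \<open>u j\<close>.\<close>
    have "coord_action n t v \<in> L" if "v \<in> L" for v
      using that
    proof (induction "card {j\<in>J. v $ j \<noteq> 0}" arbitrary: v rule: less_induct)
      case less
      show ?case
      proof (cases "\<forall>j\<in>J. v $ j = 0")
        case True
        then have "v = 0\<^sub>v n" using inj[OF less.prems] by blast
        then have "coord_action n t v = 0\<^sub>v n"
          by (auto simp: coord_action_def intro!: eq_vecI)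
        then show ?thesis using closed(1) by simp
      next
        case False
        then obtain j where j: "j \<in> J" "v $ j \<noteq> 0" by blast
        let ?w = "v + (- v $ j) \<cdot>\<^sub>v u j"
        have uc: "u j \<in> carrier_vec n" and vc: "v \<in> carrier_vec n"
          using Lc u(1)[OF j(1)] less.prems by auto
        have w: "?w $ i = v $ i - v $ j * u j $ i" if "i < n" for i using that uc vc by simp
        have wJ: "?w $ i = (if i = j then 0 else v $ i)" if "i \<in> J" for i
        proof -
          have "i < n" using that J(1) by auto
          then show ?thesis using w that j u(2,3)[OF j(1)] by auto
        qed
        have wL: "?w \<in> L" using closed less.prems u(1)[OF j(1)] by blast
        have "?w $ j = 0" using wJ[OF j(1)] by simp
        moreover have "{i\<in>J. ?w $ i \<noteq> 0} \<subseteq> {i\<in>J. v $ i \<noteq> 0}"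
          using wJ by (auto split: if_splits)
        ultimately have "{i\<in>J. ?w $ i \<noteq> 0} \<subset> {i\<in>J. v $ i \<noteq> 0}"
          using j by blast
        then have "card {i\<in>J. ?w $ i \<noteq> 0} < card {i\<in>J. v $ i \<noteq> 0}"
          using fin by (intro psubset_card_mono) auto
        then have "coord_action n t ?w \<in> L" using less.hyps wL by blast
        moreover have "coord_action n t v = coord_action n t ?w + (v $ j) \<cdot>\<^sub>v coord_action n t (u j)"
          using uc vc by (intro eq_vecI) (auto simp: coord_action_def algebra_simps)
        ultimately show ?thesis using tu[OF j(1)] closed u(1)[OF j(1)] by simp
      qed
    qed
    then show "coord_action n t ` L \<subseteq> L" by blast
  qed
qed

text \<open>The criterion for inclusion consists of equalities among entries of \<open>t\<close>, so
  it passes to the inverse entries. Inclusion under both \<open>t\<close> and its inverse yields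
  equality.\<close>

lemma stabilizer_eq:
  assumes L: "L \<in> grassmannian n k"
    and J: "J \<subseteq> {..<n}" "card J = k" "plucker n k L J \<noteq> 0"
  shows "stabilizer (torus n) (torus_action n k) L =
    {t \<in> carrier (torus n).
      \<forall>j\<in>J. \<forall>i\<in>{..<n} - J. plucker n k L (insert i (J - {j})) \<noteq> 0 \<longrightarrow> t i = t j}"
    (is "_ = {t \<in> _. ?R t}")
proof -
  have "coord_action n t ` L = L \<longleftrightarrow> ?R t" if t: "t \<in> carrier (torus n)" for t
  proof
    assume R: "?R t"
    let ?s = "\<lambda>i. inverse (t i)"
    have sub: "coord_action n t ` L \<subseteq> L" "coord_action n ?s ` L \<subseteq> L"
      using R coord_action_subset_iff[OF L J] by auto
    have "v \<in> coord_action n t ` L" if v: "v \<in> L" for v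
    proof
      show "coord_action n ?s v \<in> L" using sub v by blast
      have "t i \<noteq> 0" if "i < n" for i using t that by (auto simp: carrier_torus)
      then show "v = coord_action n t (coord_action n ?s v)"
        using grassmannianD(4)[OF L] v by (intro eq_vecI) (auto simp: coord_action_def)
    qed
    with sub show "coord_action n t ` L = L" by blast
  qed (use coord_action_subset_iff[OF L J] in blast)
  then show ?thesis using L by (auto simp: stabilizer_def torus_action_def)
qed

theorem proposition3p5:
  fixes n k :: nat and \<sigma> :: "nat set set"
  assumes "1 \<le> k" and "k \<le> n - 1"
    and "\<sigma> \<subseteq> {I. I \<subseteq> {..<n} \<and> card I = k}"
    and "stratum n k \<sigma> \<noteq> {}"
  shows "\<exists>H. subgroup H (torus n) \<and>
           (\<forall>L \<in> stratum n k \<sigma>. stabilizer (torus n) (torus_action n k) L = H)"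
proof -
  have strat: "L \<in> grassmannian n k" "\<And>I. I \<subseteq> {..<n} \<Longrightarrow> card I = k \<Longrightarrow> plucker n k L I \<noteq> 0 \<longleftrightarrow> I \<in> \<sigma>"
    if "L \<in> stratum n k \<sigma>" for L
    using that by (auto simp: stratum_def)
  obtain L0 where L0: "L0 \<in> stratum n k \<sigma>" using assms(4) by blast
  obtain J where J: "J \<subseteq> {..<n}" "card J = k" "plucker n k L0 J \<noteq> 0"
    using ex_plucker_nonzero[OF strat(1)[OF L0]] by blast
  have fin: "finite J" using J(1) finite_subset by blast
  \<comment> \<open>One \<open>J\<close>, taken from the single point \<open>L0\<close>, serves the
    whole stratum: nonvanishing at \<open>J\<close> and at its exchanged sets is membership in
    \<open>\<sigma>\<close>.\<close>
  let ?H = "{t \<in> carrier (torus n).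
      \<forall>j\<in>J. \<forall>i\<in>{..<n} - J. insert i (J - {j}) \<in> \<sigma> \<longrightarrow> t i = t j}"
  have H: "stabilizer (torus n) (torus_action n k) L = ?H" if L: "L \<in> stratum n k \<sigma>" for L
  proof -
    have "plucker n k L (insert i (J - {j})) \<noteq> 0 \<longleftrightarrow> insert i (J - {j}) \<in> \<sigma>"
      if "j \<in> J" "i \<in> {..<n} - J" for i j
    proof (rule strat(2)[OF L])
      show "insert i (J - {j}) \<subseteq> {..<n}" using that J(1) by auto
      show "card (insert i (J - {j})) = k"
        using that card.remove[OF fin that(1)] fin J(2) by simp
    qed
    moreover have "plucker n k L J \<noteq> 0" using J strat(2)[OF L0] strat(2)[OF L] by blast
    ultimately show ?thesis using stabilizer_eq[OF strat(1)[OF L] J(1,2)] by auto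
  qed
  \<comment> \<open>\<open>?H\<close> is the stabilizer of the actual point \<open>L0\<close>, so
    the subgroup property comes from the group action.\<close>
  have "subgroup ?H (torus n)"
    using group_action.stabilizer_subgroup[OF group_action_torus strat(1)[OF L0]] H[OF L0] by simp
  with H show ?thesis by blast
qed

end
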